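(* Consider the fair oblivious randomized protocol in which every informed node transmits the information $I$ at each time step (independently) with probability $p=\frac{\ln n}{n}$. For any integers $n>2$, $\alpha\ge0$, $\beta\ge 1$, any $V_{\max}>0$, and any $(\alpha,\beta)$-connected MANET of $n$ nodes (node speeds bounded by $V_{\max}$), this protocol solves the Dissemination problem in $$O\!\left(\alpha n+\left(1+\frac{\alpha}{\beta}\right)\frac{n^2}{\log n}\right)$$ time steps with probability at least $1-e^{-(n-1)/4}$, where the constant hidden in $O(\cdot)$ is absolute.
   Context: **Model.** A MANET is a set $V$ of $n$ nodes in $\mathbb{R}^2$, no two at the same point at the same time. Time is divided into slots $1,2,\dots$; positions (hence topology) change only at slot boundaries, and no node moves faster than $V_{\max}$ (measured as distance per time slot). All nodes have the same range of transmission $r>0$; two nodes are neighbors in a slot if their distance is at most $r$ during the whole slot. An active node $u$ receives a transmission from a neighbor $v$ in a slot if and only if $v$ is the only node transmitting in that slot among $u$ and its neighbors. There is no collision detection. Nodes may be activated at any slot boundary, and may fail (become inactive) and be reactivated; upon activation a node starts its algorithm from scratch, keeping no state (so a node loses $I$ when it fails). **Dissemination problem.** Given a predicate $\mathcal{Q}$ on $V$ and a source node $s\in V$ that holds a piece of information $I$ at time $t_1$, distribute $I$ to all nodes of $\{x\in V:\mathcal{Q}(x)\}$. A node is covered if it has received $I$ (the source counts as covered from $t_1$), otherwise uncovered. A node is informed at time $t$ if it holds $I$ at time $t$. The problem is solved at slot $t_2\ge t_1$ if all target nodes are covered by slot $t_2$; time is counted from $t_1$. **$(\alpha,\beta)$-connectivity**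 (integers $\alpha\ge0$, $\beta\ge1$). For every slot $t\ge t_1$ at which the problem is not yet solved there is a slot $t'$ such that $[t,t+\alpha]\cap[t',t'+\beta)\neq\emptyset$, and there are nodes $p,p'$ such that at time $t'$ $p$ is informed and $p'$ is uncovered, and $p,p'$ are active and neighbors from step $t'$ until $p'$ becomes covered or until step $t'+\beta-1$ (inclusive), whichever occurs first. **Adversary.** Placement, movement and activation schedule are chosen by an adaptive adversary, which decides at the end of each slot with access to the protocol and all nodes' internal states but not to future random bits, subject to the speed bound and $(\alpha,\beta)$-connectivity. The theorem is for every such adversary; probability is over the protocol's random bits.
   Formalization: In (α,β)-connectivity, [t,t+α] must meet the link window at a slot where p' is still uncovered; with windows counting until t'+β−1 after p' is covered, the claim fails (n=3, α=0, β large). *)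

theory Defs
  imports "HOL-Probability.Probability"
begin

text \<open>
  Nodes are natural numbers rather than elements of a type variable, so that a constant quantified
  before the network cannot depend on the number of nodes.  Slots are the numbers 1, 2, \<dots>.
\<close>

type_synonym slot = nat
type_synonym node = nat

text \<open>
  The random bits of the protocol: \<open>\<omega> (t, v)\<close> tells whether \<open>v\<close>, if it is informed in slot \<open>t\<close>,
  transmits in slot \<open>t\<close>.
\<close>

type_synonym coins = "slot \<times> node \<Rightarrow> bool"

definition coin_space :: "real \<Rightarrow> coins measure" where
  "coin_space p = Pi\<^sub>M UNIV (\<lambda>_. measure_pmf (bernoulli_pmf p))"

text \<open>
  Positions and activity are chosen by the adversary and may therefore depend on the random bits;
  see \<open>adapted\<close> below.  Positions are constant during a slot, so one position per slot suffices,
  and being in range during the whole slot is a condition on these positions.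
\<close>

record network =
  nodes :: "node set"
  tx_range :: real
  position :: "slot \<Rightarrow> coins \<Rightarrow> node \<Rightarrow> real ^ 2"
  active :: "slot \<Rightarrow> coins \<Rightarrow> node set"

text \<open>
  The choices for slot \<open>t\<close> are made at the end of slot \<open>t - 1\<close> and depend only on the bits of the
  earlier slots, which, together with the adversary's own earlier choices, determine all internal
  states of the nodes.
\<close>

definition adapted :: "network \<Rightarrow> bool" where
  "adapted N \<longleftrightarrow>
     (\<forall>t \<omega> \<omega>'. (\<forall>i v. 1 \<le> i \<and> i < t \<and> v \<in> nodes N \<longrightarrow> \<omega> (i, v) = \<omega>' (i, v)) \<longrightarrow>
        position N t \<omega> = position N t \<omega>' \<and> active N t \<omega> = active N t \<omega>')"

definition manet :: "real \<Rightarrow> network \<Rightarrow> bool" where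
  "manet Vmax N \<longleftrightarrow>
     finite (nodes N) \<and> tx_range N > 0 \<and> adapted N \<and>
     (\<forall>\<omega>. \<forall>t\<ge>1. active N t \<omega> \<subseteq> nodes N \<and> inj_on (position N t \<omega>) (nodes N) \<and>
        (\<forall>v\<in>nodes N. dist (position N t \<omega> v) (position N (Suc t) \<omega> v) \<le> Vmax))"

definition neighbors :: "network \<Rightarrow> coins \<Rightarrow> slot \<Rightarrow> node \<Rightarrow> node set" where
  "neighbors N \<omega> t u =
     {v \<in> nodes N. v \<noteq> u \<and> dist (position N t \<omega> u) (position N t \<omega> v) \<le> tx_range N}"

definition transmitters :: "coins \<Rightarrow> slot \<Rightarrow> node set \<Rightarrow> node set" where
  "transmitters \<omega> t I = {v \<in> I. \<omega> (t, v)}"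

text \<open>Here \<open>I\<close> is the set of nodes that are informed in slot \<open>t\<close>.\<close>

definition receivers :: "network \<Rightarrow> coins \<Rightarrow> slot \<Rightarrow> node set \<Rightarrow> node set" where
  "receivers N \<omega> t I =
     {u \<in> active N t \<omega>. \<exists>v \<in> neighbors N \<omega> t u.
        transmitters \<omega> t I \<inter> insert u (neighbors N \<omega> t u) = {v}}"

text \<open>
  \<open>execution N s t1 \<omega> k\<close> is the pair of the covered and the informed nodes at the beginning of
  slot \<open>t1 + k\<close>.  A node that is inactive in a slot loses the information but remains covered.
\<close>

primrec execution :: "network \<Rightarrow> node \<Rightarrow> slot \<Rightarrow> coins \<Rightarrow> nat \<Rightarrow> node set \<times> node set" where
  "execution N s t1 \<omega> 0 = ({s}, {s})"
| "execution N s t1 \<omega> (Suc k) =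
     (let (C, I) = execution N s t1 \<omega> k;
          R = receivers N \<omega> (t1 + k) I
      in (C \<union> R, (I \<union> R) \<inter> active N (t1 + Suc k) \<omega>))"

definition covered :: "network \<Rightarrow> node \<Rightarrow> slot \<Rightarrow> coins \<Rightarrow> slot \<Rightarrow> node set" where
  "covered N s t1 \<omega> t = (if t < t1 then {} else fst (execution N s t1 \<omega> (t - t1)))"

definition informed :: "network \<Rightarrow> node \<Rightarrow> slot \<Rightarrow> coins \<Rightarrow> slot \<Rightarrow> node set" where
  "informed N s t1 \<omega> t = (if t < t1 then {} else snd (execution N s t1 \<omega> (t - t1)))"

text \<open>
  Receptions in slot \<open>t2\<close> itself count for being solved at slot \<open>t2\<close>, whence the successor.
\<close>

definition solved_at ::
    "network \<Rightarrow> (node \<Rightarrow> bool) \<Rightarrow> node \<Rightarrow> slot \<Rightarrow> coins \<Rightarrow> slot \<Rightarrow> bool" where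
  "solved_at N Q s t1 \<omega> t2 \<longleftrightarrow> t1 \<le> t2 \<and> {x \<in> nodes N. Q x} \<subseteq> covered N s t1 \<omega> (Suc t2)"

text \<open>
  The window of the link from \<open>p\<close> to \<open>p'\<close> starts at \<open>t'\<close> and closes after \<open>\<beta>\<close> slots or with the
  slot in which \<open>p'\<close> becomes covered, whichever occurs first.  It is this window that must meet
  the slots from \<open>t\<close> to \<open>t + \<alpha>\<close>, that is, \<open>p'\<close> is still uncovered at the beginning of the common
  slot \<open>x\<close>.  This matters only if \<open>t' < t\<close>, since for \<open>t' \<ge> t\<close> one can take \<open>x = t'\<close>.  If a link
  whose window has been closed by covering \<open>p'\<close> were still allowed to serve as a witness until slot
  \<open>t' + \<beta> - 1\<close>, the adversary could keep the network disconnected for the rest of these \<open>\<beta>\<close> slots,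
  and no bound independent of \<open>\<beta>\<close> would hold for \<open>\<alpha> = 0\<close>.
\<close>

definition connected_manet ::
    "nat \<Rightarrow> nat \<Rightarrow> network \<Rightarrow> (node \<Rightarrow> bool) \<Rightarrow> node \<Rightarrow> slot \<Rightarrow> bool" where
  "connected_manet \<alpha> \<beta> N Q s t1 \<longleftrightarrow>
     (\<forall>\<omega>. \<forall>t\<ge>t1. \<not> solved_at N Q s t1 \<omega> t \<longrightarrow>
        (\<exists>t'\<ge>1. \<exists>p\<in>nodes N. \<exists>p'\<in>nodes N.
           (\<exists>x \<in> {t..t + \<alpha>} \<inter> {t'..<t' + \<beta>}. p' \<notin> covered N s t1 \<omega> x) \<and>
           p \<in> informed N s t1 \<omega> t' \<and> p' \<notin> covered N s t1 \<omega> t' \<and>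
           (\<forall>y \<in> {t'..<t' + \<beta>}. p' \<notin> covered N s t1 \<omega> y \<longrightarrow>
              p \<in> active N y \<omega> \<and> p' \<in> active N y \<omega> \<and> p' \<in> neighbors N \<omega> y p)))"

end

theory Submission
  imports Defs
begin

text \<open>
  Call a slot linked if some uncovered active node has an informed neighbor.  If \<open>k \<le> n\<close> of its
  neighbors are informed, that node is covered in this slot with probability at least
  \<open>k p (1 - p)\<^sup>k\<^sup>-\<^sup>1 \<ge> p / 3\<close>, whatever the adversary does, since its choices depend only on earlier
  bits.  Connectivity bounds the number of unlinked slots before the solution by \<open>\<alpha> n\<close>
  plus \<open>\<alpha> / \<beta>\<close> times the number of linked ones.  Hence a run that is still unsolved after the time bound has at
  least \<open>6 n\<^sup>2 / ln n\<close> linked slots but fewer than \<open>n - 1\<close> slots with progress, and an exponential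
  supermartingale bounds the probability of this.
\<close>

section \<open>Logarithmic estimates and the chance of a unique transmitter\<close>

text \<open>With \<open>y = ln x\<close> the claim is the square of
  \<open>y \<le> exp (y / 2)\<close>. The latter holds because \<open>(1 + y / 4)^2\<close> exceeds
  \<open>(1 - y / 4)^2\<close> by exactly \<open>y\<close>, and
  \<open>1 + y / 4 \<le> exp (y / 4)\<close>.\<close>

lemma ln_squared_le_self:
  fixes x :: real
  assumes "x \<ge> 1"
  shows "(ln x)\<^sup>2 \<le> x"
proof -
  define y where "y = ln x"
  have y: "y \<ge> 0" "exp y = x" using assms by (auto simp: y_def)
  have "y \<le> (1 + y / 4)\<^sup>2"
    using zero_le_power2[of "1 - y / 4"] by (simp add: power2_eq_square field_simps)
  also have "\<dots> \<le> (exp (y / 4))\<^sup>2"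
    using y by (intro power_mono exp_ge_add_one_self) auto
  finally have "y\<^sup>2 \<le> ((exp (y / 4))\<^sup>2)\<^sup>2"
    using y by (intro power_mono) auto
  also have "\<dots> = x"
    by (simp add: y(2) flip: power_mult exp_of_nat_mult)
  finally show ?thesis by (simp add: y_def)
qed

text \<open>By concavity, the graph of \<open>ln\<close> lies above its chord from
  \<open>(1, 0)\<close> to \<open>(n, ln n)\<close>.\<close>

lemma ln_ge_chord:
  fixes k n :: real
  assumes "1 \<le> k" "k \<le> n" "1 < n"
  shows "(k - 1) / (n - 1) * ln n \<le> ln k"
proof -
  define u where "u = (k - 1) / (n - 1)"
  have u: "0 \<le> u" "u \<le> 1" using assms by (auto simp: u_def field_simps)
  have "u * (n - 1) = k - 1" using assms by (simp add: u_def)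
  then have k: "(1 - u) * 1 + u * n = k" by (simp add: algebra_simps)
  have "ln ((1 - u) *\<^sub>R 1 + u *\<^sub>R n) \<ge> (1 - u) * ln 1 + u * ln n"
    using u assms by (intro concave_onD[OF ln_concave]) auto
  then show ?thesis using k by (simp add: u_def)
qed

text \<open>
  The logarithm of the left-hand side is concave in \<open>k\<close>, so it suffices to look at \<open>k = 1\<close> and
  \<open>k = n\<close>.
\<close>

lemma unique_transmitter_bound:
  fixes n k :: nat
  assumes n: "n > 2" and k: "1 \<le> k" "k \<le> n"
  shows "real k * (1 - ln n / n) ^ (k - 1) \<ge> 1 / 3"
proof -
  define L where "L = ln (real n)"
  define p where "p = L / n"
  have L0: "L > 0" using n by (simp add: L_def)
  have Ln: "L \<le> real n - 1" unfolding L_def using n by (intro ln_le_minus_one) auto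
  have p: "0 < p" "p < 1" using L0 Ln n by (auto simp: p_def field_simps)
  \<comment> \<open>This is \<open>ln x \<le> x - 1\<close> at
    \<open>x = 1 / (1 - p)\<close>.\<close>
  have "1 - 1 / (1 - p) \<le> ln (1 - p)"
    using ln_le_minus_one[of "1 / (1 - p)"] p by (simp add: ln_div)
  moreover have "1 - 1 / (1 - p) = - (L / (real n - L))"
    using p Ln n by (simp add: p_def field_simps)
  ultimately have lnp: "- (L / (real n - L)) \<le> ln (1 - p)" by simp
  have "L\<^sup>2 \<le> real n" unfolding L_def using n by (intro ln_squared_le_self) auto
  then have LL: "L * (L - 1) \<le> real n - L" by (simp add: power2_eq_square algebra_simps)
  \<comment> \<open>The slope \<open>L / (n - 1)\<close> of the chord nearly balances the loss
    \<open>L / (n - L)\<close> per additional silent node; the defect is at most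
    \<open>1 / (n - 1)\<close> because \<open>L^2 \<le> n\<close>.\<close>
  have eq: "L / (real n - 1) - L / (real n - L) = - (L * (L - 1) / (real n - L) / (real n - 1))"
    using n Ln by (simp add: field_simps) (simp add: minus_divide_left)
  have "(1::real) \<le> real n - L" using Ln by simp
  then have "L * (L - 1) / (real n - L) \<le> 1" using LL by simp
  then have "L * (L - 1) / (real n - L) / (real n - 1) \<le> 1 / (real n - 1)"
    using n by (intro divide_right_mono) auto
  then have br: "- (1 / (real n - 1)) \<le> L / (real n - 1) + ln (1 - p)"
    using eq lnp by linarith
  \<comment> \<open>The \<open>k - 1 \<le> n - 1\<close> defects add up to at most 1, whence the
    bound \<open>exp (-1) \<ge> 1 / 3\<close>.\<close>
  have "-1 \<le> (real k - 1) * - (1 / (real n - 1))"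
    using n k by (simp add: field_simps)
  also have "\<dots> \<le> (real k - 1) * (L / (real n - 1) + ln (1 - p))"
    using br k by (intro mult_left_mono) auto
  also have "\<dots> = (real k - 1) / (real n - 1) * L + (real k - 1) * ln (1 - p)"
    by (simp add: algebra_simps)
  also have "\<dots> \<le> ln k + (real k - 1) * ln (1 - p)"
    unfolding L_def using n k by (intro add_right_mono ln_ge_chord) auto
  also have "\<dots> = ln (real k * (1 - p) ^ (k - 1))"
    using k p by (simp add: ln_mult ln_realpow of_nat_diff)
  finally have "exp (-1) \<le> real k * (1 - p) ^ (k - 1)"
    using k p by (subst (asm) ln_ge_iff) auto
  moreover have "exp (-1) \<ge> (1 / 3 :: real)"
    using exp_le by (simp add: exp_minus field_simps)
  ultimately show ?thesis by (simp add: p_def L_def)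
qed

section \<open>Finite and infinite families of independent coins\<close>

text \<open>The events that \<open>v\<close> is the only element of \<open>K\<close> with outcome
  \<open>True\<close> are disjoint for distinct \<open>v\<close>. Each fixes the coins of
  \<open>K\<close> and leaves the others free, so it has probability
  \<open>p * (1 - p) ^ (card K - 1)\<close>.\<close>

lemma prob_exactly_one_ge:
  fixes A K :: "'a set" and p :: real
  assumes A: "finite A" "K \<subseteq> A" and p: "0 \<le> p" "p \<le> 1"
  shows "card K * (p * (1 - p) ^ (card K - 1))
       \<le> measure_pmf.prob (Pi_pmf A False (\<lambda>_. bernoulli_pmf p)) {\<eta>. \<exists>v. {x \<in> K. \<eta> x} = {v}}"
    (is "_ \<le> measure_pmf.prob ?P ?S")
proof -
  define B where "B v = (\<lambda>x. if x = v then {True} else if x \<in> K then {False} else UNIV)" for v :: 'a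
  let ?E = "\<lambda>v. PiE_dflt A False (B v)"
  have K: "finite K" using A finite_subset by auto
  have T: "measure_pmf.prob (bernoulli_pmf p) {True} = p"
    and F: "measure_pmf.prob (bernoulli_pmf p) {False} = 1 - p"
    using p by (auto simp: measure_pmf_single)
  have pr: "measure_pmf.prob ?P (?E v) = p * (1 - p) ^ (card K - 1)" if v: "v \<in> K" for v
  proof -
    have "measure_pmf.prob ?P (?E v) = (\<Prod>x\<in>A. measure_pmf.prob (bernoulli_pmf p) (B v x))"
      by (rule measure_Pi_pmf_PiE_dflt) fact
    also have "\<dots> = (\<Prod>x\<in>K. measure_pmf.prob (bernoulli_pmf p) (B v x))"
      using A v by (intro prod.mono_neutral_right) (auto simp: B_def)
    also have "\<dots> = p * (\<Prod>x\<in>K-{v}. measure_pmf.prob (bernoulli_pmf p) (B v x))"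
      using K v by (subst prod.remove[of K v]) (auto simp: B_def T)
    also have "(\<Prod>x\<in>K-{v}. measure_pmf.prob (bernoulli_pmf p) (B v x)) = (\<Prod>x\<in>K-{v}. 1 - p)"
      by (intro prod.cong) (auto simp: B_def F)
    finally show ?thesis using K v by simp
  qed
  have "card K * (p * (1 - p) ^ (card K - 1)) = (\<Sum>v\<in>K. measure_pmf.prob ?P (?E v))"
    using pr by simp
  also have "\<dots> = measure_pmf.prob ?P (\<Union>v\<in>K. ?E v)"
  proof (rule measure_pmf.finite_measure_finite_Union[symmetric])
    show "disjoint_family_on ?E K"
      unfolding disjoint_family_on_def
    proof (intro ballI impI, rule ccontr)
      fix v w assume vw: "v \<in> K" "w \<in> K" "v \<noteq> w" and "?E v \<inter> ?E w \<noteq> {}"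
      then obtain \<eta> where "\<eta> \<in> ?E v" "\<eta> \<in> ?E w" by blast
      then have "\<eta> v \<in> B v v" "\<eta> v \<in> B w v" using vw A by (auto simp: PiE_dflt_def)
      then show False using vw by (auto simp: B_def)
    qed
  qed (use K in auto)
  also have "\<dots> \<le> measure_pmf.prob ?P ?S"
  proof (rule measure_pmf.finite_measure_mono)
    show "(\<Union>v\<in>K. ?E v) \<subseteq> ?S"
    proof (rule UN_least, rule subsetI)
      fix v \<eta> assume v: "v \<in> K" and \<eta>: "\<eta> \<in> ?E v"
      have "\<eta> x \<in> B v x" if "x \<in> K" for x using that \<eta> A by (auto simp: PiE_dflt_def)
      then have "{x \<in> K. \<eta> x} = {v}" using v by (force simp: B_def split: if_splits)
      then show "\<eta> \<in> ?S" by blast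
    qed
  qed auto
  finally show ?thesis .
qed

text \<open>A supermartingale argument without conditional expectations: the coins of the last slot
  are integrated out first, with all earlier coins frozen. The earlier factors are then constants,
  and \<open>step\<close> bounds the remaining integral by 1.\<close>

lemma nn_integral_adapted_prod_le_1:
  fixes W :: "nat \<Rightarrow> (nat \<times> 'a \<Rightarrow> bool) \<Rightarrow> ennreal" and V :: "'a set" and p :: real
  defines "P \<equiv> \<lambda>A. Pi_pmf A False (\<lambda>_. bernoulli_pmf p)"
  assumes V: "finite V"
    and cong: "\<And>t \<omega> \<omega>'. (\<And>i v. 1 \<le> i \<Longrightarrow> i \<le> t \<Longrightarrow> v \<in> V \<Longrightarrow> \<omega> (i, v) = \<omega>' (i, v)) \<Longrightarrow> W t \<omega> = W t \<omega>'"
    and step: "\<And>t \<omega>. 1 \<le> t \<Longrightarrow>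
      (\<integral>\<^sup>+\<eta>. W t (\<lambda>(i, v). if i = t then \<eta> (i, v) else \<omega> (i, v)) \<partial>P ({t} \<times> V)) \<le> 1"
  shows "(\<integral>\<^sup>+\<omega>. (\<Prod>t\<in>{1..<T}. W t \<omega>) \<partial>P ({1..<T} \<times> V)) \<le> 1"
proof (induction T)
  case (Suc T)
  show ?case
  proof (cases "T = 0")
    case False
    let ?A = "{1..<T} \<times> V"
    let ?m = "\<lambda>f g x. if x \<in> ?A then f x else g x"
    have int: "{1..<Suc T} = insert T {1..<T}" using False by auto
    have "{1..<Suc T} \<times> V = ?A \<union> {T} \<times> V" using False by auto
    then have "P ({1..<Suc T} \<times> V) = map_pmf (\<lambda>(f, g). ?m f g) (pair_pmf (P ?A) (P ({T} \<times> V)))"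
      unfolding P_def using V by (simp only:) (rule Pi_pmf_union, auto)
    then have "(\<integral>\<^sup>+\<omega>. (\<Prod>t\<in>{1..<Suc T}. W t \<omega>) \<partial>P ({1..<Suc T} \<times> V)) =
      (\<integral>\<^sup>+f. \<integral>\<^sup>+g. (\<Prod>t\<in>{1..<Suc T}. W t (?m f g)) \<partial>P ({T} \<times> V) \<partial>P ?A)"
      by (simp only: nn_integral_map_pmf nn_integral_pair_pmf' case_prod_conv)
    also have "\<dots> = (\<integral>\<^sup>+f. \<integral>\<^sup>+g. (\<Prod>t\<in>{1..<T}. W t f) *
        W T (\<lambda>(i, v). if i = T then g (i, v) else f (i, v)) \<partial>P ({T} \<times> V) \<partial>P ?A)"
    proof (intro nn_integral_cong)
      fix f g
      \<comment> \<open>Both ways of combining \<open>f\<close> and \<open>g\<close> agree on the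
        slots from 1 to \<open>T\<close> and the nodes in \<open>V\<close>, and \<open>W T\<close>
        sees nothing else.\<close>
      have "W T (?m f g) = W T (\<lambda>(i, v). if i = T then g (i, v) else f (i, v))"
        by (rule cong) auto
      moreover have "(\<Prod>t\<in>{1..<T}. W t (?m f g)) = (\<Prod>t\<in>{1..<T}. W t f)"
        by (intro prod.cong cong) auto
      ultimately show "(\<Prod>t\<in>{1..<Suc T}. W t (?m f g)) = (\<Prod>t\<in>{1..<T}. W t f) *
        W T (\<lambda>(i, v). if i = T then g (i, v) else f (i, v))"
        unfolding int by (simp add: mult.commute)
    qed
    also have "\<dots> = (\<integral>\<^sup>+f. (\<Prod>t\<in>{1..<T}. W t f) *
        (\<integral>\<^sup>+g. W T (\<lambda>(i, v). if i = T then g (i, v) else f (i, v)) \<partial>P ({T} \<times> V)) \<partial>P ?A)"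
      by (simp add: nn_integral_cmult)
    also have "\<dots> \<le> (\<integral>\<^sup>+f. (\<Prod>t\<in>{1..<T}. W t f) * 1 \<partial>P ?A)"
      using False by (intro nn_integral_mono mult_left_mono step) auto
    also have "\<dots> \<le> 1" using Suc.IH by simp
    finally show ?thesis .
  qed (simp add: P_def)
qed (simp add: P_def)

text \<open>Such an event is a finite disjoint union of cylinders. Hence it is measurable, and
  computations with \<open>Pi_pmf\<close> carry over to the infinite product.\<close>

lemma prob_finite_dependence:
  fixes E :: "('i \<Rightarrow> bool) set"
  assumes F: "finite F" and dep: "\<And>\<omega> \<omega>'. (\<And>x. x \<in> F \<Longrightarrow> \<omega> x = \<omega>' x) \<Longrightarrow> \<omega> \<in> E \<longleftrightarrow> \<omega>' \<in> E"
  shows "measure (Pi\<^sub>M UNIV (\<lambda>_. measure_pmf (bernoulli_pmf p))) E =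
    measure_pmf.prob (Pi_pmf F False (\<lambda>_. bernoulli_pmf p)) E"
proof -
  let ?M = "Pi\<^sub>M (UNIV :: 'i set) (\<lambda>_. measure_pmf (bernoulli_pmf p))"
  let ?P = "Pi_pmf F False (\<lambda>_. bernoulli_pmf p)"
  interpret product_prob_space "\<lambda>_. measure_pmf (bernoulli_pmf p)" "UNIV :: 'i set"
    by unfold_locales
  \<comment> \<open>One representative for each cylinder contained in \<open>E\<close>.\<close>
  define G where "G = E \<inter> PiE_dflt F False (\<lambda>_. UNIV)"
  define cyl where "cyl g = {\<omega>. \<forall>x\<in>F. \<omega> x = g x}" for g :: "'i \<Rightarrow> bool"
  have fin: "finite G" unfolding G_def using F by (intro finite_Int disjI2 finite_PiE_dflt) auto
  have cyl_eq: "cyl g = prod_emb UNIV (\<lambda>_. measure_pmf (bernoulli_pmf p)) F (Pi\<^sub>E F (\<lambda>x. {g x}))" for g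
    by (auto simp: cyl_def prod_emb_def PiE_def Pi_def)
  have cyl_sets: "cyl g \<in> sets ?M" for g
    unfolding cyl_eq using F by (intro sets_PiM_I) auto
  have cyl_prob: "measure ?M (cyl g) = pmf ?P g" if "g \<in> G" for g
  proof -
    have "measure ?M (cyl g) = (\<Prod>x\<in>F. measure (measure_pmf (bernoulli_pmf p)) {g x})"
      unfolding cyl_eq using F by (intro measure_PiM_emb) auto
    also have "\<dots> = pmf ?P g"
      using that F by (subst pmf_Pi') (auto simp: G_def PiE_dflt_def measure_pmf_single)
    finally show ?thesis .
  qed
  have "E = (\<Union>g\<in>G. cyl g)"
  proof (intro equalityI subsetI)
    fix \<omega> assume "\<omega> \<in> E"
    let ?g = "\<lambda>x. if x \<in> F then \<omega> x else False"
    have "?g \<in> E" using dep[of \<omega> ?g] \<open>\<omega> \<in> E\<close> by simp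
    then have "?g \<in> G" by (auto simp: G_def PiE_dflt_def)
    moreover have "\<omega> \<in> cyl ?g" by (simp add: cyl_def)
    ultimately show "\<omega> \<in> (\<Union>g\<in>G. cyl g)" by blast
  next
    fix \<omega> assume "\<omega> \<in> (\<Union>g\<in>G. cyl g)"
    then obtain g where "g \<in> E" "\<forall>x\<in>F. \<omega> x = g x" by (auto simp: G_def cyl_def)
    then show "\<omega> \<in> E" using dep[of \<omega> g] by simp
  qed
  then have "measure ?M E = measure ?M (\<Union>g\<in>G. cyl g)" by simp
  also have "\<dots> = (\<Sum>g\<in>G. measure ?M (cyl g))"
  proof (rule P.finite_measure_finite_Union)
    show "disjoint_family_on cyl G"
      unfolding disjoint_family_on_def
    proof (intro ballI impI, rule ccontr)
      fix g h assume gh: "g \<in> G" "h \<in> G" "g \<noteq> h" and "cyl g \<inter> cyl h \<noteq> {}"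
      then have "g x = h x" for x by (cases "x \<in> F") (auto simp: cyl_def G_def PiE_dflt_def)
      then show False using gh by auto
    qed
  qed (use fin cyl_sets in auto)
  also have "\<dots> = measure_pmf.prob ?P G"
    using fin cyl_prob by (simp add: measure_measure_pmf_finite)
  \<comment> \<open>Samples of \<open>?P\<close> take the default value \<open>False\<close> off
    \<open>F\<close>, so \<open>E\<close> and \<open>G\<close> agree on its support.\<close>
  also have "\<dots> = measure_pmf.prob ?P (E \<inter> set_pmf ?P)"
  proof (rule measure_pmf.finite_measure_eq_AE)
    show "AE x in measure_pmf ?P. x \<in> G \<longleftrightarrow> x \<in> E \<inter> set_pmf ?P"
      using set_Pi_pmf_subset[OF F, of False "\<lambda>_. bernoulli_pmf p"]
      by (auto simp: AE_measure_pmf_iff G_def PiE_dflt_def)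
  qed auto
  finally show ?thesis by (simp add: measure_Int_set_pmf)
qed

section \<open>Counting linked and unlinked slots\<close>

text \<open>
  \<open>L\<close> are the slots with a link across the cut between informed and uncovered nodes and \<open>S\<close> those
  in which a node becomes covered.  A maximal run of slots outside \<open>L\<close> has at most \<open>\<alpha>\<close> members, and
  it is followed by \<open>\<beta>\<close> slots of \<open>L\<close> unless a member of \<open>S\<close> comes first.
\<close>

lemma card_unlinked_slots_le:
  fixes L S :: "nat \<Rightarrow> bool"
  assumes win: "\<And>t. a \<le> t \<Longrightarrow> t < T \<Longrightarrow> \<not> L t \<Longrightarrow>
      \<exists>t' e. t < t' \<and> t' \<le> t + \<alpha> \<and> t' < e \<and> (\<forall>y\<in>{t'..<e}. L y) \<and> (e = t' + \<beta> \<or> S (e - 1))"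
    and "a \<le> t" "t \<le> T"
  shows "\<beta> * card {y\<in>{t..<T}. \<not> L y} \<le> \<alpha> * card {y\<in>{t..<T}. L y}
           + \<alpha> * \<beta> * card {y\<in>{t..<T}. S y} + \<alpha> * \<beta>"
  using assms(2,3)
proof (induction "T - t" arbitrary: t rule: less_induct)
  case less
  define bad where "bad I = card {y\<in>I. \<not> L y}" for I
  define good where "good I = card {y\<in>I. L y}" for I
  define suc where "suc I = card {y\<in>I. S y}" for I
  have split: "bad {t..<T} = bad {t..<e} + bad {e..<T}" "good {t..<T} = good {t..<e} + good {e..<T}"
    "suc {t..<T} = suc {t..<e} + suc {e..<T}" if "t \<le> e" "e \<le> T" for e
  proof -
    have "card {y\<in>{t..<T}. R y} = card {y\<in>{t..<e}. R y} + card {y\<in>{e..<T}. R y}" for R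
      using that by (subst card_Un_disjoint[symmetric]) (auto intro!: arg_cong[of _ _ card])
    then show "bad {t..<T} = bad {t..<e} + bad {e..<T}" "good {t..<T} = good {t..<e} + good {e..<T}"
      "suc {t..<T} = suc {t..<e} + suc {e..<T}"
      by (simp_all add: bad_def good_def suc_def)
  qed
  \<comment> \<open>The induction splits off an initial segment: a single linked slot, or the slots
    from an unlinked \<open>t\<close> to the end \<open>e\<close> of its window.\<close>
  have IH: "\<beta> * bad {e..<T} \<le> \<alpha> * good {e..<T} + \<alpha> * \<beta> * suc {e..<T} + \<alpha> * \<beta>" if "t < e" "e \<le> T" for e
    unfolding bad_def good_def suc_def using that less.prems by (intro less.hyps) auto
  have "\<beta> * bad {t..<T} \<le> \<alpha> * good {t..<T} + \<alpha> * \<beta> * suc {t..<T} + \<alpha> * \<beta>"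
  proof (cases "t < T")
    case tT: True
    show ?thesis
    proof (cases "L t")
      case True
      have "bad {t..<Suc t} = 0" using True by (auto simp: bad_def)
      then show ?thesis using split[of "Suc t"] IH[of "Suc t"] tT
        by (simp add: algebra_simps)
    next
      case False
      then obtain t' e where te: "t < t'" "t' \<le> t + \<alpha>" "t' < e" "\<forall>y\<in>{t'..<e}. L y"
        "e = t' + \<beta> \<or> S (e - 1)"
        using win[of t] less.prems tT by blast
      have bad: "bad {t..<f} \<le> \<alpha>" if "f \<le> e" for f
      proof -
        have "bad {t..<f} \<le> card {t..<t'}"
          unfolding bad_def using that te(4) by (intro card_mono) (auto simp: not_less[symmetric])
        then show ?thesis using te by simp
      qed
      show ?thesis
      proof (cases "e \<le> T")
        case eT: True
        \<comment> \<open>The at most \<alpha> unlinked slots cost \<beta> each. They are charged to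
          the slot \<open>e - 1\<close> of \<open>S\<close> for \<open>\<alpha> * \<beta>\<close>,
          or else to \<beta> linked slots for \<alpha> each.\<close>
        have "\<beta> * bad {t..<e} \<le> \<alpha> * good {t..<e} + \<alpha> * \<beta> * suc {t..<e}"
        proof (cases "S (e - 1)")
          case True
          have "card {e - 1} \<le> suc {t..<e}"
            unfolding suc_def using True te by (intro card_mono) auto
          then have "\<beta> * (bad {t..<e} * 1) \<le> \<beta> * (\<alpha> * suc {t..<e})"
            using bad[of e] by (intro mult_le_mono) auto
          also have "\<dots> = \<alpha> * \<beta> * suc {t..<e}" by (simp only: ac_simps)
          finally show ?thesis unfolding mult_1_right by (rule trans_le_add2)
        next
          case False
          have "card {t'..<e} \<le> good {t..<e}"
            unfolding good_def using te by (intro card_mono) auto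
          then have "\<beta> \<le> good {t..<e}" using te False by simp
          then have "\<beta> * bad {t..<e} \<le> good {t..<e} * \<alpha>"
            using bad[of e] by (intro mult_le_mono) auto
          then show ?thesis by (simp add: mult.commute)
        qed
        then show ?thesis using split[of e] IH[of e] eT te by (simp add: algebra_simps)
      next
        \<comment> \<open>A window cut off by \<open>T\<close> is paid by the additive term
          \<open>\<alpha> * \<beta>\<close>; this happens only once, as no slots remain.\<close>
        case False
        then have "\<beta> * bad {t..<T} \<le> \<alpha> * \<beta>"
          using bad[of T] by (subst mult.commute) (intro mult_le_mono, auto)
        then show ?thesis by (rule trans_le_add2)
      qed
    qed
  qed (simp add: bad_def)
  then show ?case by (simp add: bad_def good_def suc_def)
qed

section \<open>Executions: monotonicity and dependence on the coins\<close>

locale dissemination =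
  fixes N :: network and Vmax :: real and s :: node and t1 :: slot
  assumes manet: "manet Vmax N" and source: "s \<in> nodes N" and start: "1 \<le> t1"
begin

lemma finite_nodes: "finite (nodes N)"
  using manet by (simp add: manet_def)

lemma active_subset: "1 \<le> t \<Longrightarrow> active N t \<omega> \<subseteq> nodes N"
  using manet by (simp add: manet_def)

lemma adapted_cong:
  assumes "\<And>i v. 1 \<le> i \<Longrightarrow> i < t \<Longrightarrow> v \<in> nodes N \<Longrightarrow> \<omega> (i, v) = \<omega>' (i, v)"
  shows "position N t \<omega> = position N t \<omega>'" "active N t \<omega> = active N t \<omega>'"
proof -
  have "adapted N" using manet by (simp add: manet_def)
  then show "position N t \<omega> = position N t \<omega>'" "active N t \<omega> = active N t \<omega>'"
    using assms unfolding adapted_def by blast+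
qed

abbreviation "cov \<omega> t \<equiv> covered N s t1 \<omega> t"
abbreviation "info \<omega> t \<equiv> informed N s t1 \<omega> t"
abbreviation "recv \<omega> t \<equiv> receivers N \<omega> t (info \<omega> t)"

lemma covered_informed_Suc:
  assumes "t1 \<le> t"
  shows "cov \<omega> (Suc t) = cov \<omega> t \<union> recv \<omega> t"
    and "info \<omega> (Suc t) = (info \<omega> t \<union> recv \<omega> t) \<inter> active N (Suc t) \<omega>"
  using assms by (simp_all add: covered_def informed_def Suc_diff_le case_prod_unfold Let_def)

lemma covered_informed_start [simp]: "cov \<omega> t1 = {s}" "info \<omega> t1 = {s}"
  by (simp_all add: covered_def informed_def)

lemma receivers_subset: "1 \<le> t \<Longrightarrow> receivers N \<omega> t I \<subseteq> nodes N"
  using active_subset[of t \<omega>] by (auto simp: receivers_def)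

lemma informed_subset_covered_subset_nodes: "info \<omega> t \<subseteq> cov \<omega> t \<and> cov \<omega> t \<subseteq> nodes N"
proof (cases "t1 \<le> t")
  case True
  then show ?thesis
  proof (induction t rule: dec_induct)
    case base
    show ?case using source by simp
  next
    case (step t)
    then show ?case using receivers_subset[of t \<omega> "info \<omega> t"] start
      by (auto simp: covered_informed_Suc)
  qed
qed (simp add: covered_def informed_def)

lemma informed_subset_covered: "info \<omega> t \<subseteq> cov \<omega> t"
  and covered_subset_nodes: "cov \<omega> t \<subseteq> nodes N"
  using informed_subset_covered_subset_nodes by auto

lemma informed_subset_nodes: "info \<omega> t \<subseteq> nodes N"
  using informed_subset_covered_subset_nodes by blast

lemma covered_mono: "t \<le> t' \<Longrightarrow> cov \<omega> t \<subseteq> cov \<omega> t'"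
proof (induction t' rule: dec_induct)
  case (step u)
  have "cov \<omega> u \<subseteq> cov \<omega> (Suc u)"
  proof (cases "t1 \<le> u")
    case True
    then show ?thesis by (auto simp: covered_informed_Suc)
  qed (simp add: covered_def)
  with step show ?case by blast
qed simp

lemma solved_at_mono: "solved_at N Q s t1 \<omega> t \<Longrightarrow> t \<le> t' \<Longrightarrow> solved_at N Q s t1 \<omega> t'"
  using covered_mono[of "Suc t" "Suc t'" \<omega>] by (auto simp: solved_at_def)

text \<open>Induction over the slots: the choices of the adversary for slot \<open>t\<close> are
  fixed by earlier coins, and the receptions in slot \<open>t\<close> add only the coins of informed
  nodes in that slot.\<close>

lemma covered_informed_cong:
  assumes "\<And>i v. 1 \<le> i \<Longrightarrow> i < t \<Longrightarrow> v \<in> nodes N \<Longrightarrow> \<omega> (i, v) = \<omega>' (i, v)"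
  shows "cov \<omega> t = cov \<omega>' t \<and> info \<omega> t = info \<omega>' t"
proof (cases "t1 \<le> t")
  case True
  then show ?thesis using assms
  proof (induction t rule: dec_induct)
    case (step t)
    have IH: "cov \<omega> t = cov \<omega>' t" "info \<omega> t = info \<omega>' t" using step by auto
    have "transmitters \<omega> t (info \<omega>' t) = transmitters \<omega>' t (info \<omega>' t)"
      using step.prems[of t] step.hyps start informed_subset_nodes[of \<omega>' t]
      by (auto simp: transmitters_def)
    moreover have "neighbors N \<omega> t = neighbors N \<omega>' t" "active N t \<omega> = active N t \<omega>'"
      using adapted_cong[of t \<omega> \<omega>'] step.prems by (simp_all add: neighbors_def fun_eq_iff)
    ultimately have "recv \<omega> t = recv \<omega>' t" by (simp add: receivers_def IH(2))
    moreover have "active N (Suc t) \<omega> = active N (Suc t) \<omega>'"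
      using step.prems by (intro adapted_cong) auto
    ultimately show ?case using step.hyps IH by (simp add: covered_informed_Suc)
  qed simp
qed (simp add: covered_def informed_def)

section \<open>Links, progress and the use of connectivity\<close>

definition link :: "coins \<Rightarrow> slot \<Rightarrow> bool" where
  "link \<omega> t \<longleftrightarrow> (\<exists>u. u \<in> active N t \<omega> - cov \<omega> t \<and> info \<omega> t \<inter> neighbors N \<omega> t u \<noteq> {})"

definition progress :: "coins \<Rightarrow> slot \<Rightarrow> bool" where
  "progress \<omega> t \<longleftrightarrow> cov \<omega> (Suc t) \<noteq> cov \<omega> t"

lemma neighbors_sym: "v \<in> neighbors N \<omega> t u \<Longrightarrow> u \<in> nodes N \<Longrightarrow> u \<in> neighbors N \<omega> t v"
  by (auto simp: neighbors_def dist_commute)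

lemma link_ge_start: "link \<omega> t \<Longrightarrow> t1 \<le> t"
  by (rule ccontr) (auto simp: link_def informed_def)

text \<open>Agreement strictly before \<open>t\<close> suffices here, whereas
  \<open>progress_cong\<close> also requires it in slot \<open>t\<close>. Thus \<open>link\<close>
  is known before the coins of slot \<open>t\<close> are tossed and can be conditioned on.\<close>

lemma link_cong:
  assumes "\<And>i v. 1 \<le> i \<Longrightarrow> i < t \<Longrightarrow> v \<in> nodes N \<Longrightarrow> \<omega> (i, v) = \<omega>' (i, v)"
  shows "link \<omega> t = link \<omega>' t"
  using covered_informed_cong[of t \<omega> \<omega>'] adapted_cong[of t \<omega> \<omega>'] assms
  by (simp add: link_def neighbors_def)

lemma progress_cong:
  assumes "\<And>i v. 1 \<le> i \<Longrightarrow> i \<le> t \<Longrightarrow> v \<in> nodes N \<Longrightarrow> \<omega> (i, v) = \<omega>' (i, v)"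
  shows "progress \<omega> t = progress \<omega>' t"
  using covered_informed_cong[of t \<omega> \<omega>'] covered_informed_cong[of "Suc t" \<omega> \<omega>'] assms
  by (simp add: progress_def)

text \<open>Every slot with progress enlarges the covered set; the inequality is strict because the
  source is covered from the start.\<close>

lemma card_progress_less_card_covered:
  assumes "t1 \<le> T"
  shows "card {t\<in>{t1..<T}. progress \<omega> t} < card (cov \<omega> T)"
  using assms
proof (induction T rule: dec_induct)
  case (step T)
  have fin: "finite (cov \<omega> t)" for t using covered_subset_nodes finite_nodes finite_subset by blast
  have sub: "cov \<omega> T \<subseteq> cov \<omega> (Suc T)" by (intro covered_mono) simp
  have int: "{t1..<Suc T} = insert T {t1..<T}" using step by auto
  show ?case
  proof (cases "progress \<omega> T")
    case True
    then have "card (cov \<omega> T) < card (cov \<omega> (Suc T))"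
      using sub fin by (intro psubset_card_mono) (auto simp: progress_def)
    moreover have "{t\<in>{t1..<Suc T}. progress \<omega> t} = insert T {t\<in>{t1..<T}. progress \<omega> t}"
      using True int by auto
    ultimately show ?thesis using step by simp
  next
    case False
    then have "{t\<in>{t1..<Suc T}. progress \<omega> t} = {t\<in>{t1..<T}. progress \<omega> t}"
      using int by auto
    then show ?thesis using step False by (simp add: progress_def)
  qed
qed simp

text \<open>This supplies the hypothesis of \<open>card_unlinked_slots_le\<close>. The two
  alternatives for \<open>e\<close> are that the window lasts for all \<beta> slots or that it
  closes by covering \<open>p'\<close>.\<close>

lemma connection_window:
  assumes conn: "connected_manet \<alpha> \<beta> N Q s t1" and t: "t1 \<le> t"
    and unsolved: "\<not> solved_at N Q s t1 \<omega> t" and nolink: "\<not> link \<omega> t"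
  shows "\<exists>t' e. t < t' \<and> t' \<le> t + \<alpha> \<and> t' < e \<and> (\<forall>y\<in>{t'..<e}. link \<omega> y) \<and>
           (e = t' + \<beta> \<or> progress \<omega> (e - 1))"
proof -
  from conn t unsolved obtain t' p p' x where p: "p \<in> nodes N" "p' \<in> nodes N"
    and x: "x \<in> {t..t + \<alpha>}" "x \<in> {t'..<t' + \<beta>}" "p' \<notin> cov \<omega> x"
    and pt: "p \<in> info \<omega> t'" "p' \<notin> cov \<omega> t'"
    and w: "\<forall>y \<in> {t'..<t' + \<beta>}. p' \<notin> cov \<omega> y \<longrightarrow>
              p \<in> active N y \<omega> \<and> p' \<in> active N y \<omega> \<and> p' \<in> neighbors N \<omega> y p"
    unfolding connected_manet_def by blast
  have t'1: "t1 \<le> t'" using pt(1) by (auto simp: informed_def split: if_splits)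
  \<comment> \<open>As long as \<open>p'\<close> is uncovered, \<open>p\<close> stays active and so
    never loses the information.\<close>
  have holds: "p \<in> info \<omega> y" if "t' \<le> y" "y < t' + \<beta>" "p' \<notin> cov \<omega> y" for y
    using that
  proof (induction y rule: dec_induct)
    case (step y)
    then have "p' \<notin> cov \<omega> y" using covered_mono[of y "Suc y" \<omega>] by auto
    then have "p \<in> info \<omega> y" using step by auto
    moreover have "p \<in> active N (Suc y) \<omega>" using w step by auto
    ultimately show ?case using step.hyps t'1 by (simp add: covered_informed_Suc)
  qed (use pt in auto)
  have lk: "link \<omega> y" if "t' \<le> y" "y < t' + \<beta>" "p' \<notin> cov \<omega> y" for y
  proof -
    have "p' \<in> neighbors N \<omega> y p" using w that by auto
    then have "p \<in> neighbors N \<omega> y p'" using p(1) by (rule neighbors_sym)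
    then have "info \<omega> y \<inter> neighbors N \<omega> y p' \<noteq> {}" using holds[OF that] by blast
    moreover have "p' \<in> active N y \<omega>" using w that by auto
    ultimately show ?thesis using that(3) unfolding link_def by blast
  qed
  \<comment> \<open>Otherwise \<open>t \<le> x < t' + \<beta>\<close>; since \<open>p'\<close> is
    uncovered at \<open>x\<close>, it is uncovered at \<open>t\<close>, and slot \<open>t\<close>
    would be linked.\<close>
  have "t < t'"
  proof (rule ccontr)
    assume "\<not> t < t'"
    then have "link \<omega> t" using x covered_mono[of t x \<omega>] by (intro lk) auto
    with nolink show False by simp
  qed
  show ?thesis
  proof (cases "p' \<in> cov \<omega> (t' + \<beta> - 1)")
    case False
    have "link \<omega> y" if "y \<in> {t'..<t' + \<beta>}" for y
    proof -
      have "cov \<omega> y \<subseteq> cov \<omega> (t' + \<beta> - 1)" using that by (intro covered_mono) auto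
      then show ?thesis using that False by (intro lk) auto
    qed
    then show ?thesis using \<open>t < t'\<close> x by (intro exI[of _ t'] exI[of _ "t' + \<beta>"]) auto
  next
    case True
    \<comment> \<open>\<open>p'\<close> is covered at the beginning of slot \<open>e\<close> for the
      first time, so the reception takes place in slot \<open>e - 1\<close>.\<close>
    define e where "e = (LEAST y. p' \<in> cov \<omega> y)"
    have e: "p' \<in> cov \<omega> e" "e \<le> t' + \<beta> - 1"
      unfolding e_def using LeastI[of "\<lambda>y. p' \<in> cov \<omega> y", OF True]
        Least_le[of "\<lambda>y. p' \<in> cov \<omega> y", OF True] by simp_all
    have before: "p' \<notin> cov \<omega> y" if "y < e" for y
      using that not_less_Least[of y "\<lambda>y. p' \<in> cov \<omega> y"] unfolding e_def by simp
    have "t' < e" using e(1) pt(2) covered_mono[of e t' \<omega>] by (cases "t' < e") auto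
    moreover have "progress \<omega> (e - 1)"
    proof -
      have "Suc (e - 1) = e" using \<open>t' < e\<close> by simp
      moreover have "p' \<notin> cov \<omega> (e - 1)" using \<open>t' < e\<close> by (intro before) simp
      ultimately show ?thesis using e(1) by (auto simp only: progress_def)
    qed
    moreover have "link \<omega> y" if "y \<in> {t'..<e}" for y
      using that before e \<open>t' < e\<close> by (intro lk) auto
    ultimately show ?thesis using \<open>t < t'\<close> x by (intro exI[of _ t'] exI[of _ e]) auto
  qed
qed

section \<open>Probability of progress and the supermartingale\<close>

text \<open>Let \<open>u\<close> be an uncovered active node with a nonempty set \<open>K\<close> of
  informed neighbors. If exactly one node of \<open>K\<close> transmits, \<open>u\<close> becomes
  covered; \<open>unique_transmitter_bound\<close> handles every size of \<open>K\<close>.\<close>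

lemma prob_progress_ge:
  assumes n: "n = card (nodes N)" "n > 2" and p: "p = ln (real n) / real n" and lk: "link \<omega> t"
  shows "measure_pmf.prob (Pi_pmf ({t} \<times> nodes N) False (\<lambda>_. bernoulli_pmf p))
    {\<eta>. progress (\<lambda>(i, v). if i = t then \<eta> (i, v) else \<omega> (i, v)) t} \<ge> p / 3"
proof -
  let ?m = "\<lambda>\<eta> (i, v). if i = t then \<eta> (i, v) else \<omega> (i, v)"
  let ?P = "Pi_pmf ({t} \<times> nodes N) False (\<lambda>_. bernoulli_pmf p)"
  from lk obtain u where u: "u \<in> active N t \<omega>" "u \<notin> cov \<omega> t" "info \<omega> t \<inter> neighbors N \<omega> t u \<noteq> {}"
    by (auto simp: link_def)
  define K where "K = info \<omega> t \<inter> neighbors N \<omega> t u"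
  define k where "k = card K"
  have t: "t1 \<le> t" by (rule link_ge_start) fact
  have KN: "K \<subseteq> nodes N" by (auto simp: K_def neighbors_def)
  have k: "1 \<le> k" "k \<le> n"
    using u(3) KN finite_nodes finite_subset[OF KN]
    by (auto simp: k_def K_def n(1) Suc_le_eq card_gt_0_iff intro!: card_mono)
  have "ln (real n) \<le> real n - 1" using n by (intro ln_le_minus_one) auto
  then have p01: "0 \<le> p" "p \<le> 1" using n(2) by (auto simp: p field_simps)
  have "p * (1 / 3) \<le> p * (real k * (1 - p) ^ (k - 1))"
    using unique_transmitter_bound[OF n(2) k] p01 by (intro mult_left_mono) (auto simp: p)
  also have "\<dots> = card ({t} \<times> K) * (p * (1 - p) ^ (card ({t} \<times> K) - 1))"
    by (simp add: k_def card_cartesian_product)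
  also have "\<dots> \<le> measure_pmf.prob ?P {\<eta>. \<exists>z. {x \<in> {t} \<times> K. \<eta> x} = {z}}"
    using KN p01 finite_nodes by (intro prob_exactly_one_ge) auto
  also have "\<dots> \<le> measure_pmf.prob ?P {\<eta>. progress (?m \<eta>) t}"
  proof (rule measure_pmf.finite_measure_mono, rule subsetI, rule CollectI)
    fix \<eta> assume "\<eta> \<in> {\<eta>. \<exists>z. {x \<in> {t} \<times> K. \<eta> x} = {z}}"
    then obtain z where z: "{x \<in> {t} \<times> K. \<eta> x} = {z}" by auto
    define v where "v = snd z"
    have v: "{w \<in> K. \<eta> (t, w)} = {v}"
    proof -
      have "{w \<in> K. \<eta> (t, w)} = snd ` {x \<in> {t} \<times> K. \<eta> x}" by force
      then show ?thesis by (simp add: z v_def)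
    qed
    \<comment> \<open>Only the coins of slot \<open>t\<close> are replaced, so the topology and the
      state at its beginning, and with them \<open>K\<close>, are the same for all
      \<open>\<eta>\<close>.\<close>
    define \<omega>' where "\<omega>' = ?m \<eta>"
    have "cov \<omega>' t = cov \<omega> t \<and> info \<omega>' t = info \<omega> t"
      by (rule covered_informed_cong) (simp add: \<omega>'_def)
    then have same: "cov \<omega>' t = cov \<omega> t" "info \<omega>' t = info \<omega> t" by simp_all
    have act: "active N t \<omega>' = active N t \<omega>" and "position N t \<omega>' = position N t \<omega>"
      by (rule adapted_cong; simp add: \<omega>'_def)+
    then have nb: "neighbors N \<omega>' t u = neighbors N \<omega> t u" by (simp add: neighbors_def)
    \<comment> \<open>An uncovered \<open>u\<close> is not informed, so \<open>insert u\<close> adds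
      no transmitter.\<close>
    have "transmitters \<omega>' t (info \<omega> t) \<inter> insert u (neighbors N \<omega> t u) = {w \<in> K. \<eta> (t, w)}"
      using u(2) informed_subset_covered[of \<omega> t] by (auto simp: transmitters_def K_def \<omega>'_def)
    moreover have "v \<in> neighbors N \<omega> t u" using v by (auto simp: K_def)
    ultimately have "u \<in> recv \<omega>' t"
      unfolding receivers_def same act using u(1) v nb by auto
    then have "progress \<omega>' t"
      using u(2) t by (auto simp: progress_def covered_informed_Suc same)
    then show "progress (?m \<eta>) t" by (simp only: \<omega>'_def)
  qed auto
  finally show ?thesis by simp
qed

text \<open>
  The factors are chosen so that their product is a supermartingale: in a slot with a link
  the conditional expectation of the factor is at most \<open>exp (q / 2) * (1 - q / 2)\<close>, where \<open>q = p / 3\<close>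
  bounds the probability of progress from below.
\<close>

definition weight :: "real \<Rightarrow> coins \<Rightarrow> slot \<Rightarrow> ennreal" where
  "weight p \<omega> t =
     (if link \<omega> t then ennreal (exp (p / 6) * (if progress \<omega> t then 1 / 2 else 1)) else 1)"

lemma weight_step:
  assumes n: "n = card (nodes N)" "n > 2" and p: "p = ln (real n) / real n"
  shows "(\<integral>\<^sup>+\<eta>. weight p (\<lambda>(i, v). if i = t then \<eta> (i, v) else \<omega> (i, v)) t
           \<partial>Pi_pmf ({t} \<times> nodes N) False (\<lambda>_. bernoulli_pmf p)) \<le> 1"
proof -
  let ?m = "\<lambda>\<eta> (i, v). if i = t then \<eta> (i, v) else \<omega> (i, v)"
  let ?P = "Pi_pmf ({t} \<times> nodes N) False (\<lambda>_. bernoulli_pmf p)"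
  let ?S = "{\<eta>. progress (?m \<eta>) t}"
  have lk: "link (?m \<eta>) t = link \<omega> t" for \<eta> by (rule link_cong) simp
  show ?thesis
  proof (cases "link \<omega> t")
    case True
    let ?q = "measure_pmf.prob ?P ?S"
    have q: "p / 3 \<le> ?q" by (rule prob_progress_ge) fact+
    have "(\<integral>\<^sup>+\<eta>. weight p (?m \<eta>) t \<partial>?P) =
      (\<integral>\<^sup>+\<eta>. ennreal (exp (p / 6) - exp (p / 6) / 2 * indicator ?S \<eta>) \<partial>?P)"
      by (intro nn_integral_cong) (simp add: weight_def lk True)
    also have "\<dots> = ennreal (\<integral>\<eta>. (exp (p / 6) - exp (p / 6) / 2 * indicator ?S \<eta>) \<partial>?P)"
      by (intro nn_integral_eq_integral)
        (auto simp: indicator_def intro!: measure_pmf.integrable_const_bound[of _ "exp (p / 6)"])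
    also have "(\<integral>\<eta>. (exp (p / 6) - exp (p / 6) / 2 * indicator ?S \<eta>) \<partial>?P) =
        exp (p / 6) * (1 - ?q / 2)"
    proof -
      have "integrable ?P (indicator ?S :: _ \<Rightarrow> real)"
        by (intro measure_pmf.integrable_const_bound[of _ 1]) auto
      then show ?thesis by (simp add: right_diff_distrib)
    qed
    finally have eq: "(\<integral>\<^sup>+\<eta>. weight p (?m \<eta>) t \<partial>?P) = ennreal (exp (p / 6) * (1 - ?q / 2))" .
    \<comment> \<open>From \<open>?q \<ge> p / 3\<close> follows
      \<open>1 - ?q / 2 \<le> 1 - p / 6 \<le> exp (- (p / 6))\<close>, which the factor
      \<open>exp (p / 6)\<close> compensates.\<close>
    have "exp (p / 6) * (1 - ?q / 2) \<le> exp (p / 6) * exp (- (p / 6))"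
      using q exp_ge_add_one_self[of "- (p / 6)"] by (intro mult_left_mono) auto
    then show ?thesis unfolding eq by (simp add: ennreal_le_1 flip: exp_add)
  qed (simp add: weight_def lk)
qed

lemma weight_cong:
  assumes "\<And>i v. 1 \<le> i \<Longrightarrow> i \<le> t \<Longrightarrow> v \<in> nodes N \<Longrightarrow> \<omega> (i, v) = \<omega>' (i, v)"
  shows "weight p \<omega> t = weight p \<omega>' t"
proof -
  have "link \<omega> t = link \<omega>' t"
    by (rule link_cong) (use assms in simp)
  moreover have "progress \<omega> t = progress \<omega>' t"
    by (rule progress_cong) (use assms in simp)
  ultimately show ?thesis by (simp add: weight_def)
qed

lemma nn_integral_weight_le_1:
  assumes "n = card (nodes N)" "n > 2" "p = ln (real n) / real n"
  shows "(\<integral>\<^sup>+\<omega>. (\<Prod>t\<in>{1..<T}. weight p \<omega> t)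
           \<partial>Pi_pmf ({1..<T} \<times> nodes N) False (\<lambda>_. bernoulli_pmf p)) \<le> 1"
proof (rule nn_integral_adapted_prod_le_1[where W = "\<lambda>t \<omega>. weight p \<omega> t"])
  show "finite (nodes N)" by (rule finite_nodes)
qed (rule weight_cong, blast, rule weight_step[OF assms])

text \<open>The comparison is made slot by slot. In a linked slot
  \<open>exp (- (3 / 4)) \<le> 1 / 2\<close> bounds the factor for progress; in an unlinked slot the
  weight is 1 and the exponent is at most 0.\<close>

lemma prod_weight_ge:
  "ennreal (exp (p / 6 * card {t\<in>{t1..<T}. link \<omega> t} - 3 / 4 * card {t\<in>{t1..<T}. progress \<omega> t}))
     \<le> (\<Prod>t\<in>{1..<T}. weight p \<omega> t)"
proof -
  have half: "exp (- (3 / 4)) \<le> (1 / 2 :: real)"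
  proof -
    have "(2::real) \<le> 1 + 3 / 4 + (3 / 4)\<^sup>2 / 2" by (simp add: power2_eq_square)
    also have "\<dots> \<le> exp (3 / 4)" by (rule exp_lower_Taylor_quadratic) simp
    finally show ?thesis by (simp add: exp_minus field_simps)
  qed
  have "exp (p / 6 * card {t\<in>{t1..<T}. link \<omega> t} - 3 / 4 * card {t\<in>{t1..<T}. progress \<omega> t}) =
      exp ((\<Sum>t\<in>{t1..<T}. p / 6 * of_bool (link \<omega> t)) - (\<Sum>t\<in>{t1..<T}. 3 / 4 * of_bool (progress \<omega> t)))"
  proof -
    have "real (card {t\<in>{t1..<T}. R t}) = (\<Sum>t\<in>{t1..<T}. of_bool (R t))" for R
      by (simp add: Int_def)
    then show ?thesis by (simp only: sum_distrib_left)
  qed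
  also have "\<dots> = (\<Prod>t\<in>{t1..<T}. exp (p / 6 * of_bool (link \<omega> t) - 3 / 4 * of_bool (progress \<omega> t)))"
    by (simp add: exp_sum flip: sum_subtractf)
  finally have "ennreal (exp (p / 6 * card {t\<in>{t1..<T}. link \<omega> t} - 3 / 4 * card {t\<in>{t1..<T}. progress \<omega> t})) =
      (\<Prod>t\<in>{t1..<T}. ennreal (exp (p / 6 * of_bool (link \<omega> t) - 3 / 4 * of_bool (progress \<omega> t))))"
    by (simp add: prod_ennreal)
  also have "\<dots> \<le> (\<Prod>t\<in>{t1..<T}. weight p \<omega> t)"
  proof (rule prod_mono_ennreal)
    fix t
    have "exp (p / 6 - 3 / 4) \<le> exp (p / 6) * (1 / 2)"
      using mult_left_mono[OF half, of "exp (p / 6)"] by (simp flip: exp_add)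
    then show "ennreal (exp (p / 6 * of_bool (link \<omega> t) - 3 / 4 * of_bool (progress \<omega> t))) \<le> weight p \<omega> t"
      by (auto simp: weight_def ennreal_le_1 simp del: times_divide_eq_right intro!: ennreal_leI)
  qed
  also have "\<dots> = (\<Prod>t\<in>{1..<T}. weight p \<omega> t)"
    using start by (intro prod.mono_neutral_left) (auto simp: weight_def dest!: link_ge_start)
  finally show ?thesis .
qed

section \<open>The tail bound\<close>

text \<open>The first bound is \<open>card_unlinked_slots_le\<close> divided by \<beta>. The 2 in
  the second accounts for the source, covered without progress, and for a node that is still
  uncovered.\<close>

lemma many_links_if_unsolved:
  assumes n: "n = card (nodes N)" and \<beta>: "1 \<le> \<beta>"
    and conn: "connected_manet \<alpha> \<beta> N Q s t1" and T: "t1 \<le> T"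
    and unsolved: "\<not> solved_at N Q s t1 \<omega> T"
  shows "real (Suc T - t1) \<le>
      (1 + real \<alpha> / real \<beta>) * card {t\<in>{t1..<Suc T}. link \<omega> t} + real \<alpha> * real n"
    and "card {t\<in>{t1..<Suc T}. progress \<omega> t} + 2 \<le> n"
proof -
  let ?good = "card {t\<in>{t1..<Suc T}. link \<omega> t}" and ?bad = "card {t\<in>{t1..<Suc T}. \<not> link \<omega> t}"
    and ?suc = "card {t\<in>{t1..<Suc T}. progress \<omega> t}"
  have "cov \<omega> (Suc T) \<noteq> nodes N" using unsolved T by (auto simp: solved_at_def)
  then have "card (cov \<omega> (Suc T)) < n"
    unfolding n using covered_subset_nodes finite_nodes by (intro psubset_card_mono) auto
  moreover have "?suc < card (cov \<omega> (Suc T))"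
    using T by (intro card_progress_less_card_covered) auto
  ultimately show suc: "?suc + 2 \<le> n" by simp
  \<comment> \<open>A run unsolved at \<open>T\<close> is unsolved at all earlier slots, so
    \<open>connection_window\<close> applies to every unlinked slot.\<close>
  have "\<beta> * ?bad \<le> \<alpha> * ?good + \<alpha> * \<beta> * ?suc + \<alpha> * \<beta>"
    using conn unsolved solved_at_mono T
    by (intro card_unlinked_slots_le[where a = t1] connection_window[where Q = Q]) auto
  also have "\<dots> = \<alpha> * ?good + \<alpha> * \<beta> * (?suc + 1)" by (simp add: algebra_simps)
  also have "\<dots> \<le> \<alpha> * ?good + \<alpha> * \<beta> * n"
    using suc by (intro add_left_mono mult_left_mono) auto
  finally have "real (\<beta> * ?bad) \<le> real (\<alpha> * ?good + \<alpha> * \<beta> * n)" by (simp only: of_nat_le_iff)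
  then have "real ?bad \<le> real \<alpha> / real \<beta> * ?good + real \<alpha> * n"
    using \<beta> by (simp add: field_simps)
  moreover have "Suc T - t1 = ?good + ?bad"
    by (subst card_Un_disjoint[symmetric]) (auto simp: card_atLeastLessThan[symmetric]
      simp del: card_atLeastLessThan intro!: arg_cong[of _ _ card])
  then have "real (Suc T - t1) = real ?good + real ?bad" by (simp only: of_nat_add)
  ultimately show "real (Suc T - t1) \<le> (1 + real \<alpha> / real \<beta>) * ?good + real \<alpha> * real n"
    by (simp add: algebra_simps)
qed

text \<open>Markov's inequality: the product of the weights has mean at most 1 and is at least
  \<open>exp ((n - 1) / 4)\<close> on every unsolved run.\<close>

lemma prob_unsolved_le:
  assumes n: "n = card (nodes N)" "n > 2" and p: "p = ln (real n) / real n" and \<beta>: "1 \<le> \<beta>"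
    and conn: "connected_manet \<alpha> \<beta> N Q s t1" and T: "t1 \<le> T"
    and long: "6 * (real \<alpha> * real n + (1 + real \<alpha> / real \<beta>) * (real n ^ 2 / ln (real n)))
                 \<le> real (Suc T - t1)"
  shows "measure_pmf.prob (Pi_pmf ({1..<Suc T} \<times> nodes N) False (\<lambda>_. bernoulli_pmf p))
           {\<omega>. \<not> solved_at N Q s t1 \<omega> T} \<le> exp (- (real n - 1) / 4)"
proof -
  let ?P = "Pi_pmf ({1..<Suc T} \<times> nodes N) False (\<lambda>_. bernoulli_pmf p)"
  let ?E = "{\<omega>. \<not> solved_at N Q s t1 \<omega> T}"
  let ?X = "\<lambda>\<omega>. \<Prod>t\<in>{1..<Suc T}. weight p \<omega> t"
  let ?c = "ennreal (exp (- (real n - 1) / 4))"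
  have X: "1 \<le> ?c * ?X \<omega>" if "\<omega> \<in> ?E" for \<omega>
  proof -
    let ?good = "card {t\<in>{t1..<Suc T}. link \<omega> t}" and ?suc = "card {t\<in>{t1..<Suc T}. progress \<omega> t}"
    have unsolved: "\<not> solved_at N Q s t1 \<omega> T" using that by simp
    note ml = many_links_if_unsolved[OF n(1) \<beta> conn T unsolved]
    define a b where "a = real \<alpha> * real n" and "b = 1 + real \<alpha> / real \<beta>"
    have ab: "a \<ge> 0" "b > 0" by (simp_all add: a_def b_def add_pos_nonneg)
    have "6 * (a + b * (real n ^ 2 / ln (real n))) \<le> b * ?good + a"
      unfolding a_def b_def using long ml(1) by (rule order_trans)
    \<comment> \<open>One of the six copies of \<open>a\<close> cancels the \<open>a\<close> on the
      right; the others are nonnegative.\<close>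
    then have "b * (6 * (real n ^ 2 / ln (real n))) \<le> b * ?good"
      using ab(1) by (simp only: distrib_left mult.left_commute)
    then have "6 * (real n ^ 2 / ln (real n)) \<le> ?good"
      using ab(2) by (rule mult_left_le_imp_le)
    moreover have "p \<ge> 0" using n by (simp add: p)
    ultimately have "p / 6 * (6 * (real n ^ 2 / ln (real n))) \<le> p / 6 * ?good"
      by (intro mult_left_mono) auto
    \<comment> \<open>The constant 6 makes the links contribute at least \<open>n\<close> to the
      exponent, while progress costs at most \<open>3 / 4 * (n - 2)\<close>.\<close>
    moreover have "p / 6 * (6 * (real n ^ 2 / ln (real n))) = n"
      using n(2) by (simp add: p power2_eq_square)
    moreover have "real ?suc \<le> real n - 2" using ml(2) by linarith
    ultimately have "(real n - 1) / 4 \<le> x - 3 / 4 * real y"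
      if "x = p / 6 * ?good" "y = ?suc" for x y
      using that by simp
    then have "(real n - 1) / 4 \<le> p / 6 * ?good - 3 / 4 * ?suc" by blast
    then have "1 \<le> exp (- (real n - 1) / 4) * exp (p / 6 * ?good - 3 / 4 * ?suc)"
      by (simp only: exp_add[symmetric] one_le_exp_iff)
    then have "1 \<le> ?c * ennreal (exp (p / 6 * ?good - 3 / 4 * ?suc))"
      by (simp flip: ennreal_mult)
    also have "\<dots> \<le> ?c * ?X \<omega>" by (intro mult_left_mono prod_weight_ge) auto
    finally show ?thesis .
  qed
  have "emeasure ?P ?E = (\<integral>\<^sup>+\<omega>. indicator ?E \<omega> \<partial>?P)" by simp
  also have "\<dots> \<le> (\<integral>\<^sup>+\<omega>. ?c * ?X \<omega> \<partial>?P)"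
    using X by (intro nn_integral_mono) (auto simp: indicator_def)
  also have "\<dots> = ?c * (\<integral>\<^sup>+\<omega>. ?X \<omega> \<partial>?P)" by (rule nn_integral_cmult) simp
  also have "\<dots> \<le> ?c * 1" by (intro mult_left_mono nn_integral_weight_le_1[OF n p]) auto
  finally show ?thesis by (simp add: measure_pmf.emeasure_eq_measure)
qed

end

theorem theorem12:
  "\<exists>C::real. C > 0 \<and>
     (\<forall>(n::nat) (\<alpha>::nat) (\<beta>::nat) (Vmax::real) (N::network) (Q::node \<Rightarrow> bool) (s::node) (t1::slot).
        n > 2 \<and> \<beta> \<ge> 1 \<and> Vmax > 0 \<and> manet Vmax N \<and> card (nodes N) = n \<and>
        t1 \<ge> 1 \<and> s \<in> nodes N \<and> (\<forall>\<omega>. s \<in> active N t1 \<omega>) \<and>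
        connected_manet \<alpha> \<beta> N Q s t1
        \<longrightarrow>
        measure (coin_space (ln (real n) / real n))
          {\<omega>. \<exists>t2. solved_at N Q s t1 \<omega> t2 \<and>
             real t2 - real t1 \<le>
               C * (real \<alpha> * real n + (1 + real \<alpha> / real \<beta>) * (real n ^ 2 / ln (real n)))}
        \<ge> 1 - exp (- (real n - 1) / 4))"
proof (intro exI[of _ "6::real"] conjI allI impI; (elim conjE)?)
  fix n \<alpha> \<beta> :: nat and Vmax :: real and N :: network and Q :: "node \<Rightarrow> bool" and s :: node and t1 :: slot
  assume n: "n > 2" "card (nodes N) = n" and \<beta>: "\<beta> \<ge> 1"
    and N: "manet Vmax N" "t1 \<ge> 1" "s \<in> nodes N" and conn: "connected_manet \<alpha> \<beta> N Q s t1"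
  interpret dissemination N Vmax s t1
    using N by unfold_locales
  define B where
    "B = 6 * (real \<alpha> * real n + (1 + real \<alpha> / real \<beta>) * (real n ^ 2 / ln (real n)))"
  \<comment> \<open>The last slot within the time bound. By monotonicity the event of the theorem is
    being solved at \<open>T\<close>, which depends on finitely many coins.\<close>
  define T where "T = t1 + nat \<lfloor>B\<rfloor>"
  define p where "p = ln (real n) / real n"
  let ?E = "{\<omega>. solved_at N Q s t1 \<omega> T}"
  let ?P = "Pi_pmf ({1..<Suc T} \<times> nodes N) False (\<lambda>_. bernoulli_pmf p)"
  have B: "B \<ge> 0" unfolding B_def using n by (intro mult_nonneg_nonneg add_nonneg_nonneg) auto
  have "(\<exists>t2. solved_at N Q s t1 \<omega> t2 \<and> real t2 - real t1 \<le> B) \<longleftrightarrow> solved_at N Q s t1 \<omega> T" for \<omega>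
  proof
    assume "\<exists>t2. solved_at N Q s t1 \<omega> t2 \<and> real t2 - real t1 \<le> B"
    then obtain t2 where t2: "solved_at N Q s t1 \<omega> t2" "real t2 - real t1 \<le> B" by blast
    then have "int t2 - int t1 \<le> \<lfloor>B\<rfloor>" by (simp add: le_floor_iff)
    then have "t2 \<le> T" unfolding T_def by linarith
    then show "solved_at N Q s t1 \<omega> T" using t2 solved_at_mono by blast
  next
    assume "solved_at N Q s t1 \<omega> T"
    moreover have "real T - real t1 \<le> B" unfolding T_def using B by simp
    ultimately show "\<exists>t2. solved_at N Q s t1 \<omega> t2 \<and> real t2 - real t1 \<le> B" by blast
  qed
  then have "measure (coin_space p) {\<omega>. \<exists>t2. solved_at N Q s t1 \<omega> t2 \<and> real t2 - real t1 \<le> B} =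
      measure (coin_space p) ?E" by simp
  also have "\<dots> = measure_pmf.prob ?P ?E"
    unfolding coin_space_def
  proof (rule prob_finite_dependence)
    fix \<omega> \<omega>' :: coins
    assume *: "\<And>x. x \<in> {1..<Suc T} \<times> nodes N \<Longrightarrow> \<omega> x = \<omega>' x"
    have "covered N s t1 \<omega> (Suc T) = covered N s t1 \<omega>' (Suc T)"
      using * covered_informed_cong[of "Suc T" \<omega> \<omega>'] by auto
    then show "\<omega> \<in> ?E \<longleftrightarrow> \<omega>' \<in> ?E" by (simp add: solved_at_def)
  qed (use finite_nodes in auto)
  also have "\<dots> = 1 - measure_pmf.prob ?P {\<omega>. \<not> solved_at N Q s t1 \<omega> T}"
  proof -
    have "{\<omega>. \<not> solved_at N Q s t1 \<omega> T} = space ?P - ?E" by auto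
    then show ?thesis using measure_pmf.prob_compl[of ?E ?P] by simp
  qed
  also have "\<dots> \<ge> 1 - exp (- (real n - 1) / 4)"
  proof -
    \<comment> \<open>Slot \<open>T\<close> itself is included, so there are
      \<open>floor B + 1\<close> slots, more than \<open>B\<close>.\<close>
    have "B \<le> real (Suc T - t1)" unfolding T_def using B by simp linarith
    then have "measure_pmf.prob ?P {\<omega>. \<not> solved_at N Q s t1 \<omega> T} \<le> exp (- (real n - 1) / 4)"
      using n \<beta> conn by (intro prob_unsolved_le) (auto simp: p_def B_def T_def)
    then show ?thesis by simp
  qed
  finally show "measure (coin_space (ln (real n) / real n))
      {\<omega>. \<exists>t2. solved_at N Q s t1 \<omega> t2 \<and>
         real t2 - real t1 \<le>
           6 * (real \<alpha> * real n + (1 + real \<alpha> / real \<beta>) * (real n ^ 2 / ln (real n)))}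
      \<ge> 1 - exp (- (real n - 1) / 4)"
    unfolding p_def B_def .
qed simp

end
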